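(* Let $\kappa$ be an uncountable regular cardinal and let $X$ be a real Banach space which is Weakly Lindelöf Determined (WLD) with $\operatorname{dens}(X)=\kappa$. (a) If $X$ is $\kappa$-asymptotically free, then player I has a winning strategy in the game $G_{X,\kappa}$. (b) If $\lambda<\kappa$ is an infinite cardinal and $X$ is $(\lambda,\kappa)$-asymptotically free, then player I has a winning strategy in the game $G_{X,\lambda^+}$.
   Context: $[\,\cdot\,]$ denotes closed linear span, $\operatorname{dens}$ the density character, $\perp$ the annihilator in the dual. WLD: $X$ is WLD iff it admits a Markushevich basis and has Corson's property (C); equivalently, $X$ has a Markushevich basis $\{(x_\alpha,g_\alpha)\}$ such that $\{\alpha:f(x_\alpha)\ne0\}$ is countable for every $f\in X^*$. (Markushevich basis: a biorthogonal system with $[x_\alpha]_\alpha=X$ and the $w^*$-closed span of $\{g_\alpha\}$ equal to $X^*$. Property (C): for any $\Gamma\subset X^*$ and $f\in\overline{\Gamma}^{w^*}$ there is a countable $\Gamma_0\subset\Gamma$ with $f\in\overline{\mathrm{conv}}^{w^*}(\Gamma_0)$.) Asymptotic freeness: for a cardinal $\lambda<\kappa$, $X$ is $(\lambda,\kappa)$-asymptotically free if for every $x\in X$, every closed subspace $Z\subset X$ with $\operatorname{dens}(Z)\le\lambda$ and every nested (decreasing) sequence $\{Z_\alpha\}_{\alpha<\kappa}$ of closed subspaces of $X$ with $Z^\perp=\bigcup_{\alpha<\kappa}Z_\alpha^\perp$: if $\|x+z\|\ge\|z\|$ for all $z\in Z$, then there is $\alpha<\kappa$ with $\|x+z\|\ge\|z\|$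 for all $z\in Z_\alpha$. $X$ is $\kappa$-asymptotically free if it is $(\lambda,\kappa)$-asymptotically free for all cardinals $\lambda<\kappa$. For $U\subset X^*$ let $\Psi(U)=\{x\in X:\sup_{f\in U\setminus\{0\}}|f(x)|/\|f\|=\|x\|\}$, $\Psi(\emptyset)=\Psi(\{0\})=\{0\}$. Game $G_{X,\nu}$ ($\nu$ an uncountable regular cardinal): at each stage $\alpha<\nu$ player I chooses a pair $(x_\alpha,Z_\alpha)$, $x_\alpha\in X$ with $\|x_\alpha\|=1$ and $Z_\alpha\subset X$ a closed linear subspace, and player II simultaneously chooses a point $y_\alpha\in X$. Player I must satisfy: (1) $Z_\beta\subset Z_\alpha$ for $\alpha<\beta$; (2) $x_\alpha\in\bigcap_{\gamma<\alpha}Z_\gamma$ (with the empty intersection being $X$); (3') $[x_\gamma,y_\gamma:\gamma<\alpha]+Z_\alpha\subset\Psi([x_\alpha]^\perp)$. The game terminates at a stage $\alpha<\nu$ if player I cannot make a legal inning; then player II wins. Otherwise player I wins. A strategy for player I is a map assigning to each history $(\{x_\alpha\}_{\alpha<\theta},\{y_\alpha\}_{\alpha<\theta},\{Z_\alpha\}_{\alpha<\theta})$ the next inning $(x_\theta,Z_\theta)$, consistently with the rules. *)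

theory Defs
  imports "HOL-Analysis.Analysis"
begin

unbundle cardinal_syntax

text \<open>
  Cardinals are the cardinal orders of the library.  The ordinals below a cardinal \<open>r\<close> are the
  elements of \<open>Field r\<close> ordered by \<open>r\<close>, and the ordinals below \<open>\<alpha>\<close> form the set \<open>underS r \<alpha>\<close>.
  The Banach space \<open>X\<close> is a whole type; its dual is the type of bounded linear maps to \<open>real\<close>.
\<close>

definition dens :: "'a::topological_space set \<Rightarrow> 'a rel" where
  "dens S = |SOME D. D \<subseteq> S \<and> S \<subseteq> closure D \<and> (\<forall>E. E \<subseteq> S \<and> S \<subseteq> closure E \<longrightarrow> |D| \<le>o |E| )|"

text \<open>A dense subset of least cardinality exists, so the choice above is meaningful.\<close>

lemma dens_attained:
  obtains D where "D \<subseteq> S" "S \<subseteq> closure D" "dens S = |D|"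
    "\<And>E. E \<subseteq> S \<Longrightarrow> S \<subseteq> closure E \<Longrightarrow> |D| \<le>o |E|"
proof -
  let ?R = "{ |D| | D. D \<subseteq> S \<and> S \<subseteq> closure D}"
  have "|S| \<in> ?R" using closure_subset by blast
  then have "\<exists>r\<in>?R. \<forall>r'\<in>?R. r \<le>o r'"
    by (intro exists_minim_Card_order) (auto simp: card_of_Card_order)
  then have ex: "\<exists>D. D \<subseteq> S \<and> S \<subseteq> closure D \<and> (\<forall>E. E \<subseteq> S \<and> S \<subseteq> closure E \<longrightarrow> |D| \<le>o |E| )"
    by blast
  show thesis
    using someI_ex[OF ex] that unfolding dens_def by blast
qed

definition closed_span :: "'a::real_normed_vector set \<Rightarrow> 'a set" where
  "closed_span A = closure (span A)"

definition closed_subspace :: "'a::real_normed_vector set \<Rightarrow> bool" where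
  "closed_subspace Z \<longleftrightarrow> subspace Z \<and> closed Z"

definition annihilator :: "'a::real_normed_vector set \<Rightarrow> ('a \<Rightarrow>\<^sub>L real) set" where
  "annihilator Z = {f. \<forall>z\<in>Z. blinfun_apply f z = 0}"

text \<open>On the dual, the strong operator topology is the topology of pointwise convergence.\<close>

abbreviation weak_star_topology :: "('a::real_normed_vector \<Rightarrow>\<^sub>L real) topology" where
  "weak_star_topology \<equiv> strong_operator_topology"

text \<open>
  A biorthogonal system \<open>(x\<^sub>\<alpha>, g\<^sub>\<alpha>)\<close> has pairwise distinct members, so it is represented by the
  set of its pairs instead of by an indexed family.
\<close>

definition markushevich_basis :: "('a::real_normed_vector \<times> ('a \<Rightarrow>\<^sub>L real)) set \<Rightarrow> bool" where
  "markushevich_basis B \<longleftrightarrow>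
     (\<forall>p\<in>B. \<forall>q\<in>B. blinfun_apply (snd p) (fst q) = (if p = q then 1 else 0)) \<and>
     closed_span (fst ` B) = UNIV \<and>
     weak_star_topology closure_of (span (snd ` B)) = UNIV"

definition property_C :: "'a::real_normed_vector itself \<Rightarrow> bool" where
  "property_C _ \<longleftrightarrow>
     (\<forall>(\<Gamma> :: ('a \<Rightarrow>\<^sub>L real) set) f. f \<in> weak_star_topology closure_of \<Gamma> \<longrightarrow>
        (\<exists>\<Gamma>\<^sub>0\<subseteq>\<Gamma>. countable \<Gamma>\<^sub>0 \<and> f \<in> weak_star_topology closure_of (convex hull \<Gamma>\<^sub>0)))"

definition weakly_Lindelof_determined :: "'a::banach itself \<Rightarrow> bool" where
  "weakly_Lindelof_determined X \<longleftrightarrow>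
     (\<exists>B :: ('a \<times> ('a \<Rightarrow>\<^sub>L real)) set. markushevich_basis B) \<and> property_C X"

definition asymptotically_free :: "'l rel \<Rightarrow> 'k rel \<Rightarrow> 'a::banach itself \<Rightarrow> bool" where
  "asymptotically_free l \<kappa> _ \<longleftrightarrow>
     (\<forall>(x :: 'a) Z (Zs :: 'k \<Rightarrow> 'a set).
        closed_subspace Z \<and> dens Z \<le>o l \<and>
        (\<forall>\<alpha>\<in>Field \<kappa>. closed_subspace (Zs \<alpha>)) \<and>
        (\<forall>\<alpha> \<beta>. (\<alpha>, \<beta>) \<in> \<kappa> \<longrightarrow> Zs \<beta> \<subseteq> Zs \<alpha>) \<and>
        annihilator Z = (\<Union>\<alpha>\<in>Field \<kappa>. annihilator (Zs \<alpha>)) \<and>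
        (\<forall>z\<in>Z. norm (x + z) \<ge> norm z)
        \<longrightarrow> (\<exists>\<alpha>\<in>Field \<kappa>. \<forall>z\<in>Zs \<alpha>. norm (x + z) \<ge> norm z))"

text \<open>Every cardinal below \<open>\<kappa>\<close> is isomorphic to a cardinal order on the type underlying \<open>\<kappa>\<close>.\<close>

definition fully_asymptotically_free :: "'k rel \<Rightarrow> 'a::banach itself \<Rightarrow> bool" where
  "fully_asymptotically_free \<kappa> X \<longleftrightarrow>
     (\<forall>l :: 'k rel. Card_order l \<and> l <o \<kappa> \<longrightarrow> asymptotically_free l \<kappa> X)"

definition Psi :: "('a::real_normed_vector \<Rightarrow>\<^sub>L real) set \<Rightarrow> 'a set" where
  "Psi U = (if U \<subseteq> {0} then {0}
            else {x. (SUP f\<in>U - {0}. \<bar>blinfun_apply f x\<bar> / norm f) = norm x})"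

definition legal_inning ::
    "'n rel \<Rightarrow> ('n \<Rightarrow> 'a::banach) \<Rightarrow> ('n \<Rightarrow> 'a) \<Rightarrow> ('n \<Rightarrow> 'a set) \<Rightarrow> 'n \<Rightarrow> bool" where
  "legal_inning \<nu> x y Z \<alpha> \<longleftrightarrow>
     norm (x \<alpha>) = 1 \<and> closed_subspace (Z \<alpha>) \<and>
     (\<forall>\<gamma>\<in>underS \<nu> \<alpha>. Z \<alpha> \<subseteq> Z \<gamma>) \<and>
     x \<alpha> \<in> (\<Inter>\<gamma>\<in>underS \<nu> \<alpha>. Z \<gamma>) \<and>
     closed_span (x ` underS \<nu> \<alpha> \<union> y ` underS \<nu> \<alpha>) + Z \<alpha> \<subseteq> Psi (annihilator (closed_span {x \<alpha>}))"

text \<open>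
  A strategy maps the current stage \<open>\<theta>\<close> and the history before \<open>\<theta>\<close> (the sequences of \<open>x\<close>, \<open>y\<close>
  and \<open>Z\<close>) to the inning at stage \<open>\<theta>\<close>.  Histories are passed as functions cut off outside
  \<open>underS \<nu> \<theta>\<close>, so a strategy cannot look at the opponent's present or future moves.
  Values at histories that do not arise under the strategy are irrelevant, so legality is demanded
  only along the plays that follow it.
\<close>

type_synonym ('n, 'a) strategy =
  "'n \<Rightarrow> ('n \<Rightarrow> 'a) \<Rightarrow> ('n \<Rightarrow> 'a) \<Rightarrow> ('n \<Rightarrow> 'a set) \<Rightarrow> 'a \<times> 'a set"

definition follows_strategy ::
    "'n rel \<Rightarrow> ('n, 'a) strategy \<Rightarrow> ('n \<Rightarrow> 'a) \<Rightarrow> ('n \<Rightarrow> 'a) \<Rightarrow> ('n \<Rightarrow> 'a set) \<Rightarrow> bool" where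
  "follows_strategy \<nu> \<sigma> x y Z \<longleftrightarrow>
     (\<forall>\<theta>\<in>Field \<nu>. (x \<theta>, Z \<theta>) =
        \<sigma> \<theta> (restrict x (underS \<nu> \<theta>)) (restrict y (underS \<nu> \<theta>)) (restrict Z (underS \<nu> \<theta>)))"

definition winning_strategy :: "'n rel \<Rightarrow> ('n, 'a::banach) strategy \<Rightarrow> bool" where
  "winning_strategy \<nu> \<sigma> \<longleftrightarrow>
     (\<forall>x y Z. follows_strategy \<nu> \<sigma> x y Z \<longrightarrow> (\<forall>\<alpha>\<in>Field \<nu>. legal_inning \<nu> x y Z \<alpha>))"

definition player_I_has_winning_strategy :: "'n rel \<Rightarrow> 'a::banach itself \<Rightarrow> bool" where
  "player_I_has_winning_strategy \<nu> _ \<longleftrightarrow> (\<exists>\<sigma> :: ('n, 'a) strategy. winning_strategy \<nu> \<sigma>)"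

text \<open>
  Against any moves of player II a strategy produces a play, so the universal
  quantification over plays in \<open>winning_strategy\<close> is never vacuous.
\<close>

lemma play_exists:
  assumes "Well_order \<nu>"
  shows "\<exists>x Z. follows_strategy \<nu> \<sigma> x y Z"
proof -
  have wf: "wf (\<nu> - Id)" using assms by (simp add: well_order_on_def)
  define G where "G = (\<lambda>f \<theta>. \<sigma> \<theta> (restrict (\<lambda>\<gamma>. fst (f \<gamma>)) (underS \<nu> \<theta>))
    (restrict y (underS \<nu> \<theta>)) (restrict (\<lambda>\<gamma>. snd (f \<gamma>)) (underS \<nu> \<theta>)))"
  define F where "F = wfrec (\<nu> - Id) G"
  have "F \<theta> = G F \<theta>" for \<theta>
  proof -
    have "F \<theta> = G (cut F (\<nu> - Id) \<theta>) \<theta>"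
      unfolding F_def by (rule wfrec[OF wf])
    moreover have "restrict (\<lambda>\<gamma>. fst (cut F (\<nu> - Id) \<theta> \<gamma>)) (underS \<nu> \<theta>)
        = restrict (\<lambda>\<gamma>. fst (F \<gamma>)) (underS \<nu> \<theta>)"
      by (rule restrict_ext) (simp add: cut_def underS_def)
    moreover have "restrict (\<lambda>\<gamma>. snd (cut F (\<nu> - Id) \<theta> \<gamma>)) (underS \<nu> \<theta>)
        = restrict (\<lambda>\<gamma>. snd (F \<gamma>)) (underS \<nu> \<theta>)"
      by (rule restrict_ext) (simp add: cut_def underS_def)
    ultimately show ?thesis by (simp only: G_def)
  qed
  then have "(fst (F \<theta>), snd (F \<theta>)) = G F \<theta>" for \<theta>
    by (simp only: prod.collapse)
  then have "follows_strategy \<nu> \<sigma> (\<lambda>\<gamma>. fst (F \<gamma>)) y (\<lambda>\<gamma>. snd (F \<gamma>))"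
    unfolding follows_strategy_def G_def by blast
  then show ?thesis by blast
qed

end

(*
  Property (C) forces every functional to have countable support on a Markushevich basis, because a
  functional is a weak-star limit of convex combinations of countably many finitely supported ones.
  Index the basis by kappa, allowing repetitions of an index.  Player I answers with a normalised
  basis vector u and a tail of the basis: at most dens Y functionals norm the closed span Y of the
  history, so all of them vanish on some basis vector of large index, and then norm (u + z) >= norm z
  on Y.  Every functional annihilating Y vanishes on a tail, so asymptotic freeness extends this
  inequality from Y to the closed span of Y and a tail.  By the Hahn-Banach theorem, the inequality
  on a subspace says that the subspace is normed by the annihilator of u.
*)

theory Submission
  imports Defs
begin

subsection \<open>The Hahn-Banach theorem\<close>

definition sublinear :: "('a::real_vector \<Rightarrow> real) \<Rightarrow> bool" where
  "sublinear p \<longleftrightarrow> (\<forall>x y. p (x + y) \<le> p x + p y) \<and> (\<forall>c\<ge>0. \<forall>x. p (c *\<^sub>R x) = c * p x)"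

text \<open>Applying the inequality to \<open>inverse c\<close> as well turns it into
  equality.\<close>

lemma sublinearI:
  assumes "\<And>x y. p (x + y) \<le> p x + p y" "\<And>c x. c > 0 \<Longrightarrow> p (c *\<^sub>R x) \<le> c * p x" "p 0 = 0"
  shows "sublinear p"
proof -
  have "p (c *\<^sub>R x) = c * p x" if "c \<ge> 0" for c x
  proof (cases "c = 0")
    case False
    with that have c: "c > 0" by simp
    have "p x \<le> inverse c * p (c *\<^sub>R x)"
      using assms(2)[of "inverse c" "c *\<^sub>R x"] c by simp
    then have "c * p x \<le> p (c *\<^sub>R x)"
      using c by (simp add: field_simps)
    then show ?thesis using assms(2)[OF c, of x] by simp
  qed (simp add: assms(3))
  then show ?thesis using assms(1) by (simp add: sublinear_def)
qed

lemma sublinear_add: "sublinear p \<Longrightarrow> p (x + y) \<le> p x + p y"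
  and sublinear_scale: "sublinear p \<Longrightarrow> c \<ge> 0 \<Longrightarrow> p (c *\<^sub>R x) = c * p x"
  by (auto simp: sublinear_def)

lemma sublinear_zero: "sublinear p \<Longrightarrow> p 0 = 0"
  using sublinear_scale[of p 0 0] by simp

lemma sublinear_ge_neg: "sublinear p \<Longrightarrow> - p (- x) \<le> p x"
  using sublinear_add[of p x "- x"] sublinear_zero[of p] by simp

lemma sublinear_norm: "sublinear norm"
  by (rule sublinearI) (auto simp: norm_triangle_ineq)

text \<open>Two instances matter. With \<open>T = {0..}\<close> and \<open>c = p w\<close> the value
  at \<open>- w\<close> is pushed down to at most \<open>- p w\<close>; with \<open>T = UNIV\<close>
  and \<open>c = 0\<close> the result is the quotient of \<open>p\<close> by the line through
  \<open>w\<close>. The condition on \<open>c\<close> bounds the infimum at \<open>x\<close> below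
  by \<open>- p (- x)\<close>.\<close>

lemma sublinear_INF_translates:
  fixes p :: "'a::real_vector \<Rightarrow> real" and c :: real
  assumes p: "sublinear p"
    and T: "0 \<in> T" "\<And>s t. s \<in> T \<Longrightarrow> t \<in> T \<Longrightarrow> s + t \<in> T" "\<And>r t. r > 0 \<Longrightarrow> t \<in> T \<Longrightarrow> r * t \<in> T"
    and c: "\<And>t. t \<in> T \<Longrightarrow> c * t \<le> p (t *\<^sub>R w)"
  defines "q \<equiv> \<lambda>x. INF t\<in>T. p (x + t *\<^sub>R w) - c * t"
  shows "sublinear q" "\<And>x t. t \<in> T \<Longrightarrow> q x \<le> p (x + t *\<^sub>R w) - c * t"
proof -
  have low: "- p (- x) \<le> p (x + t *\<^sub>R w) - c * t" if "t \<in> T" for x t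
    using c[OF that] sublinear_add[OF p, of "x + t *\<^sub>R w" "- x"] by simp
  show le: "q x \<le> p (x + t *\<^sub>R w) - c * t" if "t \<in> T" for x t
    unfolding q_def by (rule cINF_lower[OF _ that]) (use low in \<open>auto intro!: bdd_belowI\<close>)
  have ge: "m \<le> q x" if "\<And>t. t \<in> T \<Longrightarrow> m \<le> p (x + t *\<^sub>R w) - c * t" for m x
    unfolding q_def using T(1) that by (intro cINF_greatest) auto
  show "sublinear q"
  proof (rule sublinearI)
    fix x y
    \<comment> \<open>The translate by \<open>s + t\<close> is split between \<open>x\<close> and
      \<open>y\<close>; the infimum is taken over \<open>t\<close> first, then over
      \<open>s\<close>.\<close>
    have "q (x + y) - (p (x + s *\<^sub>R w) - c * s) \<le> q y" if s: "s \<in> T" for s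
    proof (rule ge)
      fix t assume t: "t \<in> T"
      show "q (x + y) - (p (x + s *\<^sub>R w) - c * s) \<le> p (y + t *\<^sub>R w) - c * t"
        using le[OF T(2)[OF s t], of "x + y"] sublinear_add[OF p, of "x + s *\<^sub>R w" "y + t *\<^sub>R w"]
        by (simp add: algebra_simps)
    qed
    then have "q (x + y) - q y \<le> q x"
      by (intro ge) (simp add: algebra_simps)
    then show "q (x + y) \<le> q x + q y" by simp
  next
    fix r :: real and x assume r: "r > 0"
    have "q (r *\<^sub>R x) / r \<le> q x"
    proof (rule ge)
      fix t assume t: "t \<in> T"
      have "q (r *\<^sub>R x) \<le> p (r *\<^sub>R (x + t *\<^sub>R w)) - c * (r * t)"
        using le[OF T(3)[OF r t], of "r *\<^sub>R x"] by (simp add: algebra_simps)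
      also have "\<dots> = r * (p (x + t *\<^sub>R w) - c * t)"
        using sublinear_scale[OF p, of r "x + t *\<^sub>R w"] r by (simp add: right_diff_distrib)
      finally show "q (r *\<^sub>R x) / r \<le> p (x + t *\<^sub>R w) - c * t"
        using r by (simp add: pos_divide_le_eq mult.commute)
    qed
    then show "q (r *\<^sub>R x) \<le> r * q x"
      using r by (simp add: field_simps)
  next
    show "q 0 = 0"
      using le[OF T(1), of 0] low[of _ 0] ge[of 0 0] sublinear_zero[OF p] by fastforce
  qed
qed

text \<open>Lowering \<open>p\<close> along the ray of \<open>w\<close> yields a sublinear minorant,
  which minimality makes equal to \<open>p\<close>; its value at \<open>- w\<close> gives
  \<open>p (- w) \<le> - p w\<close>. So \<open>p\<close> is odd, and an odd sublinear function is
  linear.\<close>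

lemma linear_if_minimal_sublinear:
  assumes p: "sublinear p" and min: "\<And>q. sublinear q \<Longrightarrow> (\<And>x. q x \<le> p x) \<Longrightarrow> q = p"
  shows "linear p"
proof -
  have odd: "p (- w) = - p w" for w
  proof -
    define q where "q = (\<lambda>x. INF t\<in>{0..}. p (x + t *\<^sub>R w) - p w * t)"
    have "p w * t \<le> p (t *\<^sub>R w)" if "t \<in> {0..}" for t
      using that sublinear_scale[OF p] by (simp add: mult.commute)
    then have q: "sublinear q" "\<And>x t. t \<ge> 0 \<Longrightarrow> q x \<le> p (x + t *\<^sub>R w) - p w * t"
      unfolding q_def using sublinear_INF_translates[OF p, of "{0..}" "p w" w] by auto
    have "q = p" using min[OF q(1)] q(2)[of 0] by simp
    then have "p (- w) \<le> - p w"
      using q(2)[of 1 "- w"] sublinear_zero[OF p] by simp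
    then show ?thesis using sublinear_ge_neg[OF p, of "w"] by simp
  qed
  show ?thesis
  proof (rule linearI)
    fix x y
    show "p (x + y) = p x + p y"
      using sublinear_add[OF p, of x y] sublinear_add[OF p, of "- x" "- y"] odd[of "x + y"]
      by (simp add: odd)
  next
    fix r :: real and x
    show "p (r *\<^sub>R x) = r *\<^sub>R p x"
    proof (cases "r \<ge> 0")
      case False
      then show ?thesis
        using sublinear_scale[OF p, of "- r" x] odd[of "r *\<^sub>R x"] by simp
    qed (simp add: sublinear_scale[OF p])
  qed
qed

text \<open>Supplies the lower bounds for Zorn's lemma. Members that are nearly optimal at
  \<open>x\<close> and at \<open>y\<close> may differ, but the smaller of the two serves both
  points, so the infimum stays subadditive.\<close>

lemma sublinear_INF_chain:
  assumes p: "\<And>q x. q \<in> C \<Longrightarrow> q x \<le> p x" and C: "C \<noteq> {}" "\<And>q. q \<in> C \<Longrightarrow> sublinear q"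
    and chain: "\<And>q r. q \<in> C \<Longrightarrow> r \<in> C \<Longrightarrow> (\<forall>x. q x \<le> r x) \<or> (\<forall>x. r x \<le> q x)"
  defines "m \<equiv> \<lambda>x. INF q\<in>C. q x"
  shows "sublinear m" "\<And>q x. q \<in> C \<Longrightarrow> m x \<le> q x"
proof -
  have low: "- p (- x) \<le> q x" if "q \<in> C" for q x
    using sublinear_ge_neg[OF C(2)[OF that], of x] p[OF that, of "- x"] by simp
  show le: "m x \<le> q x" if "q \<in> C" for q x
    unfolding m_def by (rule cINF_lower[OF _ that]) (use low in \<open>auto intro!: bdd_belowI\<close>)
  have ge: "b \<le> m x" if "\<And>q. q \<in> C \<Longrightarrow> b \<le> q x" for b x
    unfolding m_def using C(1) that by (intro cINF_greatest) auto
  show "sublinear m"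
  proof (rule sublinearI)
    fix x y
    have "m (x + y) - q x \<le> r y" if q: "q \<in> C" and r: "r \<in> C" for q r
    proof -
      obtain s where "s \<in> C" "s x \<le> q x" "s y \<le> r y"
        using chain[OF q r] q r by blast
      then show ?thesis
        using le[of s "x + y"] sublinear_add[OF C(2), of s x y] by simp
    qed
    then have "m (x + y) - q x \<le> m y" if "q \<in> C" for q
      using that ge by blast
    then have "m (x + y) - m y \<le> m x"
      by (intro ge) (simp add: algebra_simps)
    then show "m (x + y) \<le> m x + m y" by simp
  next
    fix r :: real and x assume r: "r > 0"
    have "m (r *\<^sub>R x) / r \<le> m x"
    proof (rule ge)
      fix q assume "q \<in> C"
      then show "m (r *\<^sub>R x) / r \<le> q x"
        using le[of q "r *\<^sub>R x"] sublinear_scale[OF C(2), of q r x] r by (simp add: field_simps)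
    qed
    then show "m (r *\<^sub>R x) \<le> r * m x"
      using r by (simp add: field_simps)
  next
    have "q 0 = 0" if "q \<in> C" for q using sublinear_zero C(2) that by blast
    then have "(INF q\<in>C. q 0) = (INF q\<in>C. 0)" by (intro INF_cong) auto
    then show "m 0 = 0" using C(1) by (simp add: m_def)
  qed
qed

text \<open>Zorn's lemma gives a minimal sublinear function below a lowered \<open>p\<close>, and
  minimality makes it linear.\<close>

lemma hahn_banach_sublinear:
  assumes p: "sublinear p"
  obtains f where "linear f" "\<And>x. f x \<le> p x" "f w = p w"
proof -
  txt \<open>Below \<open>p'\<close>, the value at \<open>- w\<close> is at most \<open>- p w\<close>, which forces \<open>f w = p w\<close>.\<close>
  define p' where "p' = (\<lambda>x. INF t\<in>{0..}. p (x + t *\<^sub>R w) - p w * t)"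
  have "p w * t \<le> p (t *\<^sub>R w)" if "t \<in> {0..}" for t
    using that sublinear_scale[OF p] by (simp add: mult.commute)
  then have p': "sublinear p'" "\<And>x t. t \<ge> 0 \<Longrightarrow> p' x \<le> p (x + t *\<^sub>R w) - p w * t"
    unfolding p'_def using sublinear_INF_translates[OF p, of "{0..}" "p w" w] by auto
  define A where "A = {q. sublinear q \<and> (\<forall>x. q x \<le> p' x)}"
  \<comment> \<open>The order is reversed, so the maximal element from Zorn's lemma is a minimal
    function.\<close>
  define P where "P = (\<lambda>q r :: 'a \<Rightarrow> real. \<forall>x. r x \<le> q x)"
  have "\<exists>m\<in>A. \<forall>a\<in>A. P m a \<longrightarrow> a = m"
  proof (rule predicate_Zorn)
    show "partial_order_on A (relation_of P A)"
      by (rule partial_order_on_relation_ofI) (auto simp: P_def fun_eq_iff intro: order_trans antisym)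
    fix C assume C: "C \<in> Chains (relation_of P A)"
    then have sub: "C \<subseteq> A" by (rule Chains_relation_of)
    show "\<exists>u\<in>A. \<forall>a\<in>C. P a u"
    proof (cases "C = {}")
      case True
      then show ?thesis using p'(1) by (auto simp: A_def)
    next
      case False
      have chain: "(\<forall>x. q x \<le> r x) \<or> (\<forall>x. r x \<le> q x)" if "q \<in> C" "r \<in> C" for q r
        using C that unfolding Chains_def relation_of_def P_def by auto
      have le: "q x \<le> p' x" "sublinear q" if "q \<in> C" for q x
        using that sub by (auto simp: A_def)
      have sub_m: "sublinear (\<lambda>x. INF q\<in>C. q x)"
        by (rule sublinear_INF_chain(1)[of C p']) (use le False chain in auto)
      have m_le: "(INF q\<in>C. q x) \<le> r x" if "r \<in> C" for r x
        by (rule sublinear_INF_chain(2)[of C p']) (use le False chain that in auto)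
      obtain r where r: "r \<in> C" using False by blast
      have "(INF q\<in>C. q x) \<le> p' x" for x
        using m_le[OF r] le(1)[OF r] by (rule order_trans)
      then show ?thesis
        using sub_m m_le unfolding A_def P_def
        by (intro bexI[of _ "\<lambda>x. INF q\<in>C. q x"]) auto
    qed
  qed
  then obtain f where f: "f \<in> A" "\<And>q. q \<in> A \<Longrightarrow> (\<And>x. q x \<le> f x) \<Longrightarrow> q = f"
    unfolding P_def by blast
  have le: "f x \<le> p' x" for x using f(1) by (simp add: A_def)
  have "linear f"
  proof (rule linear_if_minimal_sublinear)
    show "sublinear f" using f(1) by (simp add: A_def)
    fix q assume q: "sublinear q" "\<And>x. q x \<le> f x"
    then have "q \<in> A" using order_trans[OF q(2) le] by (auto simp: A_def)
    then show "q = f" using f(2) q(2) by blast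
  qed
  moreover have le_p: "f x \<le> p x" for x
    using le[of x] p'(2)[of 0 x] by simp
  moreover have "f w = p w"
    using le[of "- w"] p'(2)[of 1 "- w"] le_p[of w] sublinear_zero[OF p]
      linear_neg[OF \<open>linear f\<close>, of w] by simp
  ultimately show thesis by (rule that)
qed

text \<open>The dominating \<open>p\<close> is the distance to the line through \<open>u\<close>: it
  is at most 0 at \<open>u\<close> and \<open>- u\<close>, which forces \<open>f u = 0\<close>, and
  the hypothesis says that it equals the norm at \<open>w\<close>. Taking \<open>u = 0\<close> gives
  an ordinary norming functional.\<close>

lemma norming_functional:
  fixes w u :: "'a::real_normed_vector"
  assumes "\<And>t. norm (w + t *\<^sub>R u) \<ge> norm w"
  obtains f :: "'a \<Rightarrow>\<^sub>L real" where "blinfun_apply f w = norm w" "blinfun_apply f u = 0"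
    "\<And>x. \<bar>blinfun_apply f x\<bar> \<le> norm x"
proof -
  define p where "p = (\<lambda>x. INF t\<in>UNIV. norm (x + t *\<^sub>R u) - 0 * t)"
  have p: "sublinear p" and le: "p x \<le> norm (x + t *\<^sub>R u)" for x t
    using sublinear_INF_translates[OF sublinear_norm, of UNIV 0 u] unfolding p_def by auto
  obtain f where f: "linear f" "\<And>x. f x \<le> p x" "f w = p w"
    using hahn_banach_sublinear[OF p] by blast
  have bound: "\<bar>f x\<bar> \<le> norm x" for x
    using f(2)[of x] f(2)[of "- x"] le[of x 0] le[of "- x" 0] linear_neg[OF f(1), of x] by auto
  then have "bounded_linear f"
    by (intro bounded_linear_intro[of f 1])
      (auto simp: linear_add[OF f(1)] linear_scale[OF f(1)])
  moreover have "f u = 0"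
    using f(2)[of u] f(2)[of "- u"] le[of u "- 1"] le[of "- u" 1] linear_neg[OF f(1), of u] by auto
  moreover have "p w = norm w"
    unfolding p_def using assms
    by (intro antisym cINF_greatest) (use le[of w 0] in \<open>auto simp: p_def\<close>)
  ultimately show thesis
    using f(3) bound by (intro that[of "Blinfun f"]) (auto simp: bounded_linear_Blinfun_apply)
qed

subsection \<open>Closed spans and annihilators\<close>

lemma annihilator_closed_span:
  "annihilator (closed_span S) = {f. \<forall>s\<in>S. blinfun_apply f s = 0}"
proof -
  have "blinfun_apply f z = 0" if "\<forall>s\<in>S. blinfun_apply f s = 0" "z \<in> closure (span S)" for f z
  proof -
    have "closed {x. blinfun_apply f x = 0}"
      by (intro closed_Collect_eq continuous_intros)
    moreover have "span S \<subseteq> {x. blinfun_apply f x = 0}"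
      using that(1) linear_eq_0_on_span[OF bounded_linear.linear[OF blinfun.bounded_linear_right]] by blast
    ultimately show ?thesis using that(2) closure_minimal by blast
  qed
  moreover have "S \<subseteq> closure (span S)"
    using span_superset closure_subset by blast
  ultimately show ?thesis
    unfolding annihilator_def closed_span_def by blast
qed

lemma closed_span_mono: "S \<subseteq> T \<Longrightarrow> closed_span S \<subseteq> closed_span T"
  unfolding closed_span_def by (intro closure_mono span_mono)

lemma closed_subspace_closed_span: "closed_subspace (closed_span S)"
proof -
  have add: "x + y \<in> closure (span S)" if xy: "x \<in> closure (span S)" "y \<in> closure (span S)" for x y
  proof -
    obtain a b where "\<forall>n. a n \<in> span S" "a \<longlonglongrightarrow> x" "\<forall>n. b n \<in> span S" "b \<longlonglongrightarrow> y"
      using xy unfolding closure_sequential by blast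
    then have "\<forall>n. a n + b n \<in> span S" "(\<lambda>n. a n + b n) \<longlonglongrightarrow> x + y"
      by (auto intro: span_add tendsto_add)
    then show ?thesis
      unfolding closure_sequential by (intro exI[of _ "\<lambda>n. a n + b n"] conjI)
  qed
  have scale: "c *\<^sub>R x \<in> closure (span S)" if x: "x \<in> closure (span S)" for c x
  proof -
    obtain a where "\<forall>n. a n \<in> span S" "a \<longlonglongrightarrow> x"
      using x unfolding closure_sequential by blast
    then have "\<forall>n. c *\<^sub>R a n \<in> span S" "(\<lambda>n. c *\<^sub>R a n) \<longlonglongrightarrow> c *\<^sub>R x"
      by (auto intro: span_scale tendsto_scaleR)
    then show ?thesis
      unfolding closure_sequential by (intro exI[of _ "\<lambda>n. c *\<^sub>R a n"] conjI)
  qed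
  have "0 \<in> closure (span S)" using span_zero closure_subset by blast
  then show ?thesis
    using add scale unfolding closed_subspace_def closed_span_def subspace_def by simp
qed

section \<open>Orthogonality to a vector and norming by its annihilator\<close>

text \<open>The functional that norms \<open>w\<close> and kills \<open>u\<close> lies in the
  annihilator and attains the supremum.\<close>

lemma mem_Psi_annihilator:
  assumes "\<And>t. norm (w + t *\<^sub>R u) \<ge> norm w"
  shows "w \<in> Psi (annihilator (closed_span {u}))"
proof -
  define U where "U = annihilator (closed_span {u})"
  define h where "h = (\<lambda>f. \<bar>blinfun_apply f w\<bar> / norm f)"
  have le: "h f \<le> norm w" for f
    unfolding h_def using norm_blinfun[of f w]
    by (cases "f = 0") (auto simp: field_simps)
  obtain f where f: "blinfun_apply f w = norm w" "blinfun_apply f u = 0"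
    "\<And>x. \<bar>blinfun_apply f x\<bar> \<le> norm x"
    using norming_functional[OF assms] by blast
  have fU: "f \<in> U" unfolding U_def annihilator_closed_span using f(2) by simp
  show ?thesis
  \<comment> \<open>The zero vector belongs to both branches of \<open>Psi\<close>: to
    \<open>{0}\<close>, and as a supremum of the constant 0 over a nonempty set.\<close>
  proof (cases "w = 0")
    case True
    then show ?thesis unfolding Psi_def by (auto simp: cSUP_const)
  next
    case False
    then have nz: "f \<noteq> 0" using f(1) by auto
    have "norm f \<le> 1" using f(3) by (intro norm_blinfun_bound) auto
    then have "norm w \<le> h f"
      using nz f(1) by (simp add: h_def field_simps mult_left_le)
    with le have "h f = norm w" by (intro antisym)
    then have "(SUP f\<in>U - {0}. h f) = norm w"
      using fU nz le by (intro cSup_eq_maximum) (auto intro: rev_image_eqI)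
    then show ?thesis
      unfolding Psi_def using fU nz by (auto simp: U_def h_def)
  qed
qed

text \<open>Asymptotic freeness controls only the coefficient 1 of \<open>u\<close>. Writing
  \<open>w + t u\<close> as \<open>t (u + w / t)\<close> reaches every other nonzero
  \<open>t\<close>, since \<open>V\<close> is closed under scaling.\<close>

lemma orthogonal_subspace_scaleR:
  assumes "subspace V" "\<And>z. z \<in> V \<Longrightarrow> norm (u + z) \<ge> norm z" "w \<in> V"
  shows "norm (w + t *\<^sub>R u) \<ge> norm (w::'a::real_normed_vector)"
proof (cases "t = 0")
  case False
  have "norm (inverse t *\<^sub>R w) \<le> norm (u + inverse t *\<^sub>R w)"
    using assms(2)[OF subspace_scale[OF assms(1,3)]] .
  then have "\<bar>t\<bar> * norm (inverse t *\<^sub>R w) \<le> \<bar>t\<bar> * norm (u + inverse t *\<^sub>R w)"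
    by (rule mult_left_mono) simp
  then have "norm (t *\<^sub>R inverse t *\<^sub>R w) \<le> norm (t *\<^sub>R (u + inverse t *\<^sub>R w))"
    by (simp only: norm_scaleR)
  then show ?thesis using False by (simp add: scaleR_add_right add.commute)
qed simp

section \<open>Supports of functionals on a Markushevich basis\<close>

lemma countable_support:
  fixes B :: "('a::real_normed_vector \<times> ('a \<Rightarrow>\<^sub>L real)) set"
  assumes B: "markushevich_basis B" and C: "property_C TYPE('a)"
  shows "countable {p \<in> B. blinfun_apply f (fst p) \<noteq> (0::real)}"
proof -
  have "f \<in> weak_star_topology closure_of span (snd ` B)"
    using B by (simp add: markushevich_basis_def)
  then obtain G where G: "G \<subseteq> span (snd ` B)" "countable G"
    "f \<in> weak_star_topology closure_of (convex hull G)"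
    using C unfolding property_C_def by blast
  \<comment> \<open>By biorthogonality each coordinate functional adds at most one point to the
    support.\<close>
  have finite_support: "finite {p \<in> B. blinfun_apply g (fst p) \<noteq> 0}" if "g \<in> span (snd ` B)" for g
    using that
  proof (induction rule: span_induct_alt)
    case (step c g h)
    then obtain q where q: "q \<in> B" "g = snd q" by blast
    have "blinfun_apply g (fst p) = 0" if "p \<in> B" "p \<noteq> q" for p
      using B q that by (simp add: markushevich_basis_def)
    then have "{p \<in> B. blinfun_apply (c *\<^sub>R g + h) (fst p) \<noteq> 0}
        \<subseteq> insert q {p \<in> B. blinfun_apply h (fst p) \<noteq> 0}"
      by (auto simp: blinfun.add_left blinfun.scaleR_left)
    then show ?case using step(2) finite_subset by blast
  qed simp
  have "countable (\<Union>g\<in>G. {p \<in> B. blinfun_apply g (fst p) \<noteq> 0})"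
    using G finite_support by (intro countable_UN) (auto intro: countable_finite)
  \<comment> \<open>Evaluation at \<open>x\<close> is linear and weak-star continuous, so vanishing
    at \<open>x\<close> passes from \<open>G\<close> to its convex hull and to the closure. Hence
    the support of \<open>f\<close> lies in the union of the supports of \<open>G\<close>.\<close>
  moreover have "blinfun_apply f x = 0" if "\<forall>g\<in>G. blinfun_apply g x = 0" for x
  proof -
    let ?K = "{g \<in> topspace weak_star_topology. blinfun_apply g x \<in> {0}}"
    have "closedin weak_star_topology ?K"
      by (rule closedin_continuous_map_preimage[OF strong_operator_topology_continuous_evaluation])
        simp
    moreover have "convex hull G \<subseteq> ?K"
    proof (rule hull_minimal)
      show "G \<subseteq> ?K" using that by (simp add: strong_operator_topology_topspace subset_iff)
      show "convex ?K"
        by (auto simp: convex_def strong_operator_topology_topspace blinfun.add_left blinfun.scaleR_left)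
    qed
    ultimately show ?thesis using G(3) closure_of_minimal by blast
  qed
  then have "{p \<in> B. blinfun_apply f (fst p) \<noteq> 0}
      \<subseteq> (\<Union>g\<in>G. {p \<in> B. blinfun_apply g (fst p) \<noteq> 0})"
    by blast
  ultimately show ?thesis by (rule countable_subset[rotated])
qed

subsection \<open>Cardinality and density\<close>

text \<open>Real coefficients are approximated by rational ones, one summand at a time, so a small
  set \<open>E\<close> can be dense in the span.\<close>

lemma span_subset_closure_if_rational_closed:
  fixes A :: "'a::real_normed_vector set"
  assumes "0 \<in> E" "\<And>x q a. x \<in> E \<Longrightarrow> q \<in> \<rat> \<Longrightarrow> a \<in> A \<Longrightarrow> x + q *\<^sub>R a \<in> E"
  shows "span A \<subseteq> closure E"
proof
  fix x assume "x \<in> span A"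
  then show "x \<in> closure E"
  proof (induction rule: span_induct_alt)
    case base
    then show ?case using assms(1) closure_subset by blast
  next
    case (step c a x)
    obtain e where e: "\<forall>n. e n \<in> E" "e \<longlonglongrightarrow> x"
      using step(2) closure_sequential by blast
    have "c \<in> closure \<rat>" by (simp add: Rats_closure_real)
    then obtain q where q: "\<forall>n. q n \<in> \<rat>" "q \<longlonglongrightarrow> c"
      using closure_sequential by blast
    have "(\<lambda>n. e n + q n *\<^sub>R a) \<longlonglongrightarrow> x + c *\<^sub>R a"
      using e q by (intro tendsto_intros)
    moreover have "e n + q n *\<^sub>R a \<in> E" for n
      using assms(2) e q step(1) by blast
    ultimately show ?case
      unfolding closure_sequential
      by (intro exI[of _ "\<lambda>n. e n + q n *\<^sub>R a"]) (simp add: add.commute)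
  qed
qed

lemma countable_ordLeq_nat: "countable A \<Longrightarrow> |A| \<le>o |UNIV :: nat set|"
  unfolding countable_def card_of_ordLeq[symmetric] by blast

lemma countable_ordLeq_infinite: "countable A \<Longrightarrow> infinite B \<Longrightarrow> |A| \<le>o |B|"
  using countable_ordLeq_nat infinite_iff_card_of_nat ordLeq_transitive by blast

lemma nat_ordLess_if_uncountable: "natLeq <o r \<Longrightarrow> |UNIV :: nat set| <o r"
  using card_of_nat ordIso_ordLess_trans by blast

lemma infinite_Field_if_uncountable:
  assumes "Card_order r" "natLeq <o r"
  shows "infinite (Field r)"
proof -
  have "natLeq \<le>o |Field r|"
    using ordLess_imp_ordLeq[OF assms(2)] ordIso_symmetric[OF card_of_Field_ordIso[OF assms(1)]]
    by (rule ordLeq_ordIso_trans)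
  then show ?thesis using infinite_iff_natLeq_ordLeq by blast
qed

text \<open>An infinite \<open>I\<close> absorbs countable sets; for finite \<open>I\<close> the
  union is countable and lies below the uncountable \<open>r\<close>.\<close>

lemma card_of_UN_countable_ordLess:
  assumes "natLeq <o r" "|I| <o r" "\<And>i. i \<in> I \<Longrightarrow> countable (A i)"
  shows "|\<Union>i\<in>I. A i| <o r"
proof (cases "finite I")
  case True
  then have "countable (\<Union>i\<in>I. A i)" using assms(3) by (simp add: countable_finite)
  then show ?thesis
    using ordLeq_ordLess_trans[OF countable_ordLeq_nat nat_ordLess_if_uncountable[OF assms(1)]]
    by blast
next
  case False
  have "|A i| \<le>o |I|" if "i \<in> I" for i
    using assms(3)[OF that] False by (rule countable_ordLeq_infinite)
  then have "|\<Union>i\<in>I. A i| \<le>o |I|"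
    using False card_of_mono1[OF subset_refl] by (intro card_of_UNION_ordLeq_infinite) auto
  then show ?thesis using assms(2) ordLeq_ordLess_trans by blast
qed

text \<open>The finite rational combinations of \<open>A\<close> are dense, and there are at most
  \<open>|A|\<close> plus countably many of them.\<close>

lemma dens_closed_span_ordLess:
  fixes A :: "'a::real_normed_vector set"
  assumes r: "Card_order r" "natLeq <o r" and A: "|A| <o r"
  shows "dens (closed_span A) <o r"
proof -
  \<comment> \<open>Adding the naturals makes the bounding set infinite even for finite
    \<open>A\<close>, while its cardinality stays below \<open>r\<close>.\<close>
  define C where "C = A <+> (UNIV :: nat set)"
  have natC: "|UNIV :: nat set| \<le>o |C|" and AC: "|A| \<le>o |C|"
    unfolding C_def by (rule card_of_Plus2, rule card_of_Plus1)
  have inf: "infinite C" unfolding C_def by simp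
  have C: "|C| <o r"
    unfolding C_def
    using card_of_Plus_ordLess_infinite_Field[OF infinite_Field_if_uncountable[OF r] r(1) A
        nat_ordLess_if_uncountable[OF r(2)]] .
  have QC: "|\<rat> :: real set| \<le>o |C|"
    using countable_rat inf by (rule countable_ordLeq_infinite)
  \<comment> \<open>\<open>E n\<close> holds the sums of \<open>n\<close> rational multiples of
    members of \<open>A\<close>.\<close>
  define E where "E = rec_nat {0 :: 'a} (\<lambda>_ S. (\<lambda>(x, q, a). x + q *\<^sub>R a) ` (S \<times> (\<rat> \<times> A)))"
  have E0: "E 0 = {0}" and ESuc: "E (Suc n) = (\<lambda>(x, q, a). x + q *\<^sub>R a) ` (E n \<times> (\<rat> \<times> A))" for n
    by (simp_all add: E_def)
  have "|E n| \<le>o |C|" for n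
  proof (induction n)
    case 0
    then show ?case unfolding E0 using inf by (intro card_of_singl_ordLeq) auto
  next
    case (Suc n)
    have "|(\<rat> :: real set) \<times> A| \<le>o |C|"
      using QC AC inf by (intro card_of_Sigma_ordLeq_infinite) auto
    then have "|E n \<times> ((\<rat> :: real set) \<times> A)| \<le>o |C|"
      using Suc inf by (intro card_of_Sigma_ordLeq_infinite) auto
    then show ?case unfolding ESuc using card_of_image ordLeq_transitive by blast
  qed
  then have EC: "|\<Union>n. E n| \<le>o |C|"
    using inf natC by (intro card_of_UNION_ordLeq_infinite) auto
  have "span A \<subseteq> closure (\<Union>n. E n)"
  proof (rule span_subset_closure_if_rational_closed)
    show "0 \<in> (\<Union>n. E n)" using E0 by blast
    fix x a and q :: real assume "x \<in> (\<Union>n. E n)" and qa: "q \<in> \<rat>" "a \<in> A"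
    then obtain n where "x \<in> E n" by blast
    then have "x + q *\<^sub>R a \<in> E (Suc n)" unfolding ESuc using qa by force
    then show "x + q *\<^sub>R a \<in> (\<Union>n. E n)" by blast
  qed
  then have "closed_span A \<subseteq> closure (\<Union>n. E n)"
    unfolding closed_span_def by (simp add: closure_minimal)
  moreover have "E n \<subseteq> span A" for n
    by (induction n) (auto simp: E0 ESuc intro!: span_add span_scale span_zero intro: span_base)
  then have "(\<Union>n. E n) \<subseteq> closed_span A"
    unfolding closed_span_def using closure_subset by blast
  ultimately have "dens (closed_span A) \<le>o |\<Union>n. E n|"
    using dens_attained[of "closed_span A"] by fastforce
  then show ?thesis using EC C ordLeq_transitive ordLeq_ordLess_trans by blast
qed

section \<open>Choosing indices below a regular cardinal\<close>

lemma small_subset_bounded: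
  assumes r: "Card_order r" "regularCard r" and K: "K \<subseteq> Field r" "|K| <o r"
  obtains b where "b \<in> Field r" "\<And>a. a \<in> K \<Longrightarrow> (a, b) \<in> r"
proof -
  have "\<not> cofinal K r"
    using r K unfolding regularCard_def using not_ordLess_ordIso by blast
  \<comment> \<open>\<open>cofinal\<close> asks for strictly larger elements, so its failure gives a
    bound that may itself belong to \<open>K\<close>.\<close>
  then obtain b where b: "b \<in> Field r" "\<forall>a\<in>K. (b, a) \<notin> r \<or> b = a"
    unfolding cofinal_def by blast
  have "wo_rel r" using r(1) by (simp add: wo_rel_def card_order_on_well_order_on)
  then have "(a, b) \<in> r" if "a \<in> K" for a
    using b K(1) that by (intro wo_rel.in_notinI[of r b a]) auto
  then show thesis using that[OF b(1)] by blast
qed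

text \<open>The image of \<open>S\<close> and the initial segment below \<open>b\<close> together
  have fewer than \<open>r\<close> elements, so some index avoids both. Since it avoids the whole
  image, \<open>\<rho>\<close> may repeat values.\<close>

lemma large_index_outside_small_set:
  assumes r: "Card_order r" "natLeq <o r" and B: "\<rho> ` B = Field r"
    and S: "|S| <o r" and b: "b \<in> Field r"
  obtains p where "p \<in> B" "p \<notin> S" "(b, \<rho> p) \<in> r"
proof -
  have "|\<rho> ` S \<union> underS r b| <o r"
    using infinite_Field_if_uncountable[OF r] r(1) card_of_underS[OF r(1) b]
      ordLeq_ordLess_trans[OF card_of_image S]
    by (intro card_of_Un_ordLess_infinite_Field)
  then have "\<not> Field r \<subseteq> \<rho> ` S \<union> underS r b"
    using r(1) by (meson card_of_Field_ordIso card_of_mono1 not_ordLess_ordLeq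
        ordIso_iff_ordLeq ordLeq_transitive)
  then obtain c where c: "c \<in> Field r" "c \<notin> \<rho> ` S" "c \<notin> underS r b" by blast
  have "wo_rel r" using r(1) by (simp add: wo_rel_def card_order_on_well_order_on)
  then have "(b, c) \<in> r"
    using wo_rel.in_notinI[of r c b] b c unfolding underS_def by blast
  moreover obtain p where "p \<in> B" "\<rho> p = c" using B c(1) by (auto elim!: equalityE)
  ultimately show thesis using that[of p] c(2) by auto
qed

subsection \<open>The game\<close>

text \<open>\<open>\<rho>\<close> assigns the ordinal indices; in the game \<open>e\<close> is
  \<open>fst\<close>, so a tail consists of basis vectors.\<close>

definition tail :: "'k rel \<Rightarrow> ('b \<Rightarrow> 'k) \<Rightarrow> ('b \<Rightarrow> 'a) \<Rightarrow> 'b set \<Rightarrow> 'k \<Rightarrow> 'a set" where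
  "tail \<kappa> \<rho> e B \<xi> = e ` {p \<in> B. (\<xi>, \<rho> p) \<in> \<kappa>}"

lemma tail_antimono: "trans \<kappa> \<Longrightarrow> (\<xi>, \<eta>) \<in> \<kappa> \<Longrightarrow> tail \<kappa> \<rho> e B \<eta> \<subseteq> tail \<kappa> \<rho> e B \<xi>"
  unfolding tail_def by (auto dest: transD)

lemma asymptotically_freeD:
  fixes x :: "'a::banach" and X :: "'a itself"
  assumes "asymptotically_free l \<kappa> X"
    and "closed_subspace Z" "dens Z \<le>o l" "\<forall>\<alpha>\<in>Field \<kappa>. closed_subspace (Zs \<alpha>)"
    "\<forall>\<alpha> \<beta>. (\<alpha>, \<beta>) \<in> \<kappa> \<longrightarrow> Zs \<beta> \<subseteq> Zs \<alpha>" "annihilator Z = (\<Union>\<alpha>\<in>Field \<kappa>. annihilator (Zs \<alpha>))"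
    "\<forall>z\<in>Z. norm (x + z) \<ge> norm z"
  shows "\<exists>\<alpha>\<in>Field \<kappa>. \<forall>z\<in>Zs \<alpha>. norm (x + z) \<ge> norm z"
  using assms(1)[unfolded asymptotically_free_def, rule_format, of Z Zs x] assms(2-) by simp

text \<open>Also carries freeness between cardinal orders on different types.\<close>

lemma asymptotically_free_mono:
  fixes X :: "'a::banach itself"
  assumes "asymptotically_free l \<kappa> X" "l' \<le>o l"
  shows "asymptotically_free l' \<kappa> X"
  unfolding asymptotically_free_def
proof (intro allI impI, elim conjE, goal_cases)
  case (1 x Z Zs)
  show ?case
    using assms(1) 1(1) ordLeq_transitive[OF 1(2) assms(2)] 1(3-6) by (rule asymptotically_freeD)
qed

text \<open>A smaller basis would span a space of density below \<open>\<kappa>\<close>.\<close>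

lemma uncountable_dens_ordLeq_markushevich_basis:
  fixes B :: "('a::real_normed_vector \<times> ('a \<Rightarrow>\<^sub>L real)) set"
  assumes \<kappa>: "Card_order \<kappa>" "natLeq <o \<kappa>" "\<kappa> \<le>o dens (UNIV :: 'a set)"
    and B: "markushevich_basis B"
  shows "\<kappa> \<le>o |B|"
proof (rule ccontr)
  assume "\<not> \<kappa> \<le>o |B|"
  then have "|B| <o \<kappa>"
    using \<kappa>(1) by (simp add: card_order_on_well_order_on card_of_Well_order not_ordLeq_iff_ordLess)
  then have "|fst ` B| <o \<kappa>" using card_of_image ordLeq_ordLess_trans by blast
  then have "dens (closed_span (fst ` B)) <o \<kappa>"
    by (rule dens_closed_span_ordLess[OF \<kappa>(1,2)])
  then show False
    using \<kappa>(3) B not_ordLess_ordLeq by (auto simp: markushevich_basis_def)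
qed

text \<open>One move of player I: \<open>A\<close> holds the vectors played so far, \<open>K\<close>
  the indices of the tails already announced. The bound on \<open>A\<close> keeps the density of the
  history below \<open>\<nu>\<close>, where freeness is available.\<close>

lemma inning_exists:
  fixes B :: "('a::banach \<times> ('a \<Rightarrow>\<^sub>L real)) set" and \<kappa> :: "'k rel" and \<nu> :: "'n rel"
  assumes \<kappa>: "Card_order \<kappa>" "natLeq <o \<kappa>" "regularCard \<kappa>"
    and \<nu>: "Card_order \<nu>" "natLeq <o \<nu>" "\<nu> \<le>o \<kappa>"
    and B: "markushevich_basis B" "property_C TYPE('a)"
    and \<rho>: "\<rho> ` B = Field \<kappa>"
    and free: "\<forall>l :: 'a rel. Card_order l \<and> l <o \<nu> \<longrightarrow> asymptotically_free l \<kappa> TYPE('a)"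
    and A: "|A| <o \<nu>" and K: "K \<subseteq> Field \<kappa>" "|K| <o \<kappa>"
  shows "\<exists>\<xi>\<in>Field \<kappa>. \<exists>u. norm u = 1
    \<and> (\<forall>k\<in>K. u \<in> closed_span (tail \<kappa> \<rho> fst B k)
          \<and> closed_span (tail \<kappa> \<rho> fst B \<xi>) \<subseteq> closed_span (tail \<kappa> \<rho> fst B k))
    \<and> closed_span A + closed_span (tail \<kappa> \<rho> fst B \<xi>) \<subseteq> Psi (annihilator (closed_span {u}))"
proof -
  have wo: "wo_rel \<kappa>" using \<kappa>(1) by (simp add: wo_rel_def card_order_on_well_order_on)
  define Y where "Y = closed_span A"
  define t where "t = tail \<kappa> \<rho> fst B"
  have t_mono: "t \<eta> \<subseteq> t \<xi>" if "(\<xi>, \<eta>) \<in> \<kappa>" for \<xi> \<eta>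
    unfolding t_def using wo_rel.TRANS[OF wo] that by (rule tail_antimono)
  \<comment> \<open>Basis vectors with index from \<open>\<eta>\<close> on lie in all earlier
    tails.\<close>
  obtain \<eta> where \<eta>: "\<eta> \<in> Field \<kappa>" "\<And>k. k \<in> K \<Longrightarrow> (k, \<eta>) \<in> \<kappa>"
    using small_subset_bounded[OF \<kappa>(1,3) K] by blast
  have dY: "dens Y <o \<nu>" unfolding Y_def by (rule dens_closed_span_ordLess[OF \<nu>(1,2) A])
  obtain D where D: "D \<subseteq> Y" "Y \<subseteq> closure D" "dens Y = |D|"
    by (rule dens_attained[of Y]) (rule that)
  have D\<kappa>: "|D| <o \<kappa>" using dY D(3) \<nu>(3) ordLess_ordLeq_trans by metis
  have "\<exists>f :: 'a \<Rightarrow>\<^sub>L real. blinfun_apply f d = norm d \<and> (\<forall>x. \<bar>blinfun_apply f x\<bar> \<le> norm x)" for d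
    using norming_functional[of d 0] by auto
  then obtain F :: "'a \<Rightarrow> 'a \<Rightarrow>\<^sub>L real"
    where F: "\<And>d. blinfun_apply (F d) d = norm d" "\<And>d x. \<bar>blinfun_apply (F d) x\<bar> \<le> norm x"
    by metis
  \<comment> \<open>Fewer than \<open>\<kappa>\<close> countable supports leave room for a basis
    vector, beyond \<open>\<eta>\<close>, that every \<open>F d\<close> kills.\<close>
  have "|\<Union>d\<in>D. {p \<in> B. blinfun_apply (F d) (fst p) \<noteq> 0}| <o \<kappa>"
    using countable_support[OF B] by (intro card_of_UN_countable_ordLess[OF \<kappa>(2) D\<kappa>])
  then obtain b where b: "b \<in> B" "\<And>d. d \<in> D \<Longrightarrow> blinfun_apply (F d) (fst b) = 0" "(\<eta>, \<rho> b) \<in> \<kappa>"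
    by (rule large_index_outside_small_set[OF \<kappa>(1,2) \<rho> _ \<eta>(1)]) (rule that, auto)
  have "blinfun_apply (snd b) (fst b) = 1" using B(1) b(1) by (simp add: markushevich_basis_def)
  then have nz: "fst b \<noteq> 0" by auto
  define u where "u = fst b /\<^sub>R norm (fst b)"
  have u1: "norm u = 1" unfolding u_def using nz by simp
  have u0: "blinfun_apply (F d) u = 0" if "d \<in> D" for d
    unfolding u_def using b(2)[OF that] by (simp add: blinfun.scaleR_right)
  have Yu: "norm z \<le> norm (u + z)" if "z \<in> Y" for z
  proof -
    \<comment> \<open>\<open>F d\<close> takes the value \<open>norm d\<close> at
      \<open>u + d\<close>; the inequality then passes from \<open>D\<close> to \<open>Y\<close>
      because it defines a closed set.\<close>
    have "norm d \<le> norm (u + d)" if "d \<in> D" for d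
      using F(2)[of d "u + d"] by (simp add: blinfun.add_right u0[OF that] F(1))
    then have "D \<subseteq> {z. norm z \<le> norm (u + z)}" by blast
    moreover have "closed {z. norm z \<le> norm (u + z)}"
      by (intro closed_Collect_le continuous_intros)
    ultimately show ?thesis using D(2) that closure_minimal by blast
  qed
  \<comment> \<open>The nested subspaces for freeness: each contains \<open>Y\<close> and a tail, so
    the inequality obtained covers their sum.\<close>
  define V where "V = (\<lambda>\<alpha>. closed_span (A \<union> t \<alpha>))"
  have "annihilator Y \<subseteq> (\<Union>\<alpha>\<in>Field \<kappa>. annihilator (V \<alpha>))"
  proof
    fix f assume f: "f \<in> annihilator Y"
    let ?S = "{p \<in> B. blinfun_apply f (fst p) \<noteq> 0}"
    have "|?S| <o \<kappa>"
      using countable_ordLeq_nat[OF countable_support[OF B]] nat_ordLess_if_uncountable[OF \<kappa>(2)]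
      by (rule ordLeq_ordLess_trans)
    then have small: "|\<rho> ` ?S| <o \<kappa>" using card_of_image ordLeq_ordLess_trans by blast
    have "\<rho> ` ?S \<subseteq> Field \<kappa>" using \<rho> by auto
    then obtain \<beta> where \<beta>: "\<beta> \<in> Field \<kappa>" "\<And>a. a \<in> \<rho> ` ?S \<Longrightarrow> (a, \<beta>) \<in> \<kappa>"
      by (rule small_subset_bounded[OF \<kappa>(1,3) _ small]) (rule that)
    \<comment> \<open>A tail includes its own index and \<open>\<beta>\<close> may be the index of a
      support vector, so a strictly larger index is taken.\<close>
    obtain \<gamma> where \<gamma>: "\<gamma> \<in> Field \<kappa>" "\<beta> \<noteq> \<gamma>" "(\<beta>, \<gamma>) \<in> \<kappa>"
      using infinite_Card_order_limit[OF \<kappa>(1) infinite_Field_if_uncountable[OF \<kappa>(1,2)] \<beta>(1)]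
      by blast
    have "blinfun_apply f (fst p) = 0" if "p \<in> B" "(\<gamma>, \<rho> p) \<in> \<kappa>" for p
    proof (rule ccontr)
      assume "blinfun_apply f (fst p) \<noteq> 0"
      then have "(\<rho> p, \<beta>) \<in> \<kappa>" using \<beta>(2) that(1) by blast
      then have "(\<gamma>, \<beta>) \<in> \<kappa>" using that(2) wo_rel.TRANS[OF wo] by (blast dest: transD)
      then show False using \<gamma> wo_rel.ANTISYM[OF wo] by (blast dest: antisymD)
    qed
    moreover have "blinfun_apply f a = 0" if "a \<in> A" for a
      using f that by (simp add: Y_def annihilator_closed_span)
    ultimately have "f \<in> annihilator (V \<gamma>)"
      unfolding V_def annihilator_closed_span by (auto simp: t_def tail_def)
    then show "f \<in> (\<Union>\<alpha>\<in>Field \<kappa>. annihilator (V \<alpha>))" using \<gamma>(1) by blast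
  qed
  moreover have "annihilator (V \<alpha>) \<subseteq> annihilator Y" for \<alpha>
    unfolding V_def Y_def annihilator_closed_span by blast
  ultimately have ann: "annihilator Y = (\<Union>\<alpha>\<in>Field \<kappa>. annihilator (V \<alpha>))" by blast
  have closed: "closed_subspace Y" "\<forall>\<alpha>\<in>Field \<kappa>. closed_subspace (V \<alpha>)"
    unfolding Y_def V_def by (simp_all add: closed_subspace_closed_span)
  have nested: "\<forall>\<alpha> \<beta>. (\<alpha>, \<beta>) \<in> \<kappa> \<longrightarrow> V \<beta> \<subseteq> V \<alpha>"
    unfolding V_def using t_mono by (intro allI impI closed_span_mono) blast
  have dens_le: "dens Y \<le>o |D|" using D(3) card_of_mono1[OF subset_refl] by simp
  have "asymptotically_free |D| \<kappa> TYPE('a)"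
    using free card_of_Card_order[of D] dY D(3) by simp
  then have "\<exists>\<alpha>\<in>Field \<kappa>. \<forall>z\<in>V \<alpha>. norm z \<le> norm (u + z)"
    using closed(1) dens_le closed(2) nested ann by (rule asymptotically_freeD) (simp add: Yu)
  then obtain \<alpha> where \<alpha>: "\<alpha> \<in> Field \<kappa>" "\<And>z. z \<in> V \<alpha> \<Longrightarrow> norm z \<le> norm (u + z)"
    by blast
  \<comment> \<open>Above \<open>\<eta>\<close> the new tail lies in all earlier ones; above
    \<open>\<alpha>\<close> it lies in \<open>V \<alpha>\<close>.\<close>
  obtain \<xi> where \<xi>: "\<xi> \<in> Field \<kappa>" "(\<eta>, \<xi>) \<in> \<kappa>" "(\<alpha>, \<xi>) \<in> \<kappa>"
    using wo_rel.TOTALS[OF wo] \<alpha>(1) \<eta>(1) by blast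
  show ?thesis
  proof (intro bexI[OF _ \<xi>(1)] exI[of _ u] conjI ballI u1)
    fix k assume k: "k \<in> K"
    have "(k, \<rho> b) \<in> \<kappa>"
      using \<eta>(2)[OF k] b(3) wo_rel.TRANS[OF wo] by (blast dest: transD)
    then have "fst b \<in> span (t k)" using b(1) by (intro span_base) (auto simp: t_def tail_def)
    then have "u \<in> span (t k)" unfolding u_def by (rule span_scale)
    then show "u \<in> closed_span (tail \<kappa> \<rho> fst B k)"
      unfolding closed_span_def t_def using closure_subset by blast
    have "(k, \<xi>) \<in> \<kappa>"
      using \<eta>(2)[OF k] \<xi>(2) wo_rel.TRANS[OF wo] by (blast dest: transD)
    then show "closed_span (tail \<kappa> \<rho> fst B \<xi>) \<subseteq> closed_span (tail \<kappa> \<rho> fst B k)"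
      using t_mono unfolding t_def by (intro closed_span_mono)
  next
    have sub: "subspace (V \<alpha>)"
      unfolding V_def using closed_subspace_closed_span closed_subspace_def by blast
    have YV: "Y \<subseteq> V \<alpha>" "closed_span (t \<xi>) \<subseteq> V \<alpha>"
      unfolding Y_def V_def using t_mono[OF \<xi>(3)] by (intro closed_span_mono; blast)+
    show "closed_span A + closed_span (tail \<kappa> \<rho> fst B \<xi>) \<subseteq> Psi (annihilator (closed_span {u}))"
    proof
      fix w assume "w \<in> closed_span A + closed_span (tail \<kappa> \<rho> fst B \<xi>)"
      then obtain y z where "w = y + z" "y \<in> Y" "z \<in> closed_span (t \<xi>)"
        unfolding Y_def t_def by (rule set_plus_elim)
      then have "w \<in> V \<alpha>" using YV subspace_add[OF sub] by blast
      then show "w \<in> Psi (annihilator (closed_span {u}))"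
        using orthogonal_subspace_scaleR[OF sub \<alpha>(2)] by (intro mem_Psi_annihilator) blast
    qed
  qed
qed

section \<open>The strategy and its plays\<close>

text \<open>Transfers legality between a play and its cut-off history completed by the current
  inning.\<close>

lemma legal_inning_cong:
  assumes "\<And>\<gamma>. \<gamma> \<in> underS \<nu> \<alpha> \<Longrightarrow> x \<gamma> = x' \<gamma> \<and> y \<gamma> = y' \<gamma> \<and> Z \<gamma> = Z' \<gamma>"
    and "x \<alpha> = x' \<alpha>" "Z \<alpha> = Z' \<alpha>"
  shows "legal_inning \<nu> x y Z \<alpha> \<longleftrightarrow> legal_inning \<nu> x' y' Z' \<alpha>"
proof -
  have "x ` underS \<nu> \<alpha> = x' ` underS \<nu> \<alpha>" "y ` underS \<nu> \<alpha> = y' ` underS \<nu> \<alpha>"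
    using assms(1) by (auto intro!: image_cong)
  then show ?thesis
    unfolding legal_inning_def using assms by simp
qed

text \<open>Covers both claims, with \<open>\<nu> = \<kappa>\<close> and
  \<open>\<nu> = cardSuc l\<close>.\<close>

lemma winning_strategy_exists:
  fixes B :: "('a::banach \<times> ('a \<Rightarrow>\<^sub>L real)) set" and \<kappa> :: "'k rel" and X :: "'a itself" and \<nu> :: "'n rel"
  assumes \<kappa>: "Card_order \<kappa>" "natLeq <o \<kappa>" "regularCard \<kappa>" "\<kappa> \<le>o dens (UNIV :: 'a set)"
    and \<nu>: "Card_order \<nu>" "natLeq <o \<nu>" "\<nu> \<le>o \<kappa>"
    and B: "markushevich_basis B" "property_C TYPE('a)"
    and free: "\<forall>l :: 'a rel. Card_order l \<and> l <o \<nu> \<longrightarrow> asymptotically_free l \<kappa> TYPE('a)"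
  shows "player_I_has_winning_strategy \<nu> X"
proof -
  have ne: "Field \<kappa> \<noteq> {}" using infinite_Field_if_uncountable[OF \<kappa>(1,2)] by auto
  have "|Field \<kappa>| \<le>o |B|"
    using card_of_Field_ordIso[OF \<kappa>(1)]
      uncountable_dens_ordLeq_markushevich_basis[OF \<kappa>(1,2,4) B(1)]
    by (rule ordIso_ordLeq_trans)
  then obtain \<rho> where \<rho>: "\<rho> ` B = Field \<kappa>"
    using iffD2[OF card_of_ordLeq2[OF ne]] by blast
  define W where "W \<xi> = closed_span (tail \<kappa> \<rho> fst B \<xi>)" for \<xi>
  \<comment> \<open>Besides legality, the subspace must be the closed span of a tail. This invariant
    lets later moves recover indices from a history that shows only subspaces.\<close>
  define good where "good = (\<lambda>\<theta> x y Z p. legal_inning \<nu> (x(\<theta> := fst p)) y (Z(\<theta> := snd p)) \<theta>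
    \<and> snd p \<in> W ` Field \<kappa>)"
  define \<sigma> :: "('n, 'a) strategy" where "\<sigma> = (\<lambda>\<theta> x y Z. SOME p. good \<theta> x y Z p)"
  have good_exists: "\<exists>p. good \<theta> x y Z p"
    if \<theta>: "\<theta> \<in> Field \<nu>" and Z: "\<And>\<gamma>. \<gamma> \<in> underS \<nu> \<theta> \<Longrightarrow> Z \<gamma> \<in> W ` Field \<kappa>" for \<theta> x y Z
  proof -
    have small: "|f ` underS \<nu> \<theta>| <o \<nu>" for f :: "'n \<Rightarrow> 'c"
      using card_of_image card_of_underS[OF \<nu>(1) \<theta>] by (rule ordLeq_ordLess_trans)
    obtain k where k: "\<And>\<gamma>. \<gamma> \<in> underS \<nu> \<theta> \<Longrightarrow> k \<gamma> \<in> Field \<kappa> \<and> Z \<gamma> = W (k \<gamma>)"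
      using Z unfolding image_iff by metis
    have xy: "|x ` underS \<nu> \<theta> \<union> y ` underS \<nu> \<theta>| <o \<nu>"
      using infinite_Field_if_uncountable[OF \<nu>(1,2)] \<nu>(1) small small
      by (rule card_of_Un_ordLess_infinite_Field)
    have k_Field: "k ` underS \<nu> \<theta> \<subseteq> Field \<kappa>" using k by blast
    have k_small: "|k ` underS \<nu> \<theta>| <o \<kappa>" using small \<nu>(3) by (rule ordLess_ordLeq_trans)
    obtain u \<xi> where u: "\<xi> \<in> Field \<kappa>" "norm u = 1"
      "\<forall>c\<in>k ` underS \<nu> \<theta>. u \<in> W c \<and> W \<xi> \<subseteq> W c"
      "closed_span (x ` underS \<nu> \<theta> \<union> y ` underS \<nu> \<theta>) + W \<xi> \<subseteq> Psi (annihilator (closed_span {u}))"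
      using inning_exists[OF \<kappa>(1-3) \<nu> B \<rho> free xy k_Field k_small, folded W_def]
      by (elim bexE exE conjE)
    have "\<theta> \<notin> underS \<nu> \<theta>" by (simp add: underS_def)
    then have "x(\<theta> := u) ` underS \<nu> \<theta> = x ` underS \<nu> \<theta>" by (auto intro!: image_cong)
    then have "legal_inning \<nu> (x(\<theta> := u)) y (Z(\<theta> := W \<xi>)) \<theta>"
      unfolding legal_inning_def using u k \<open>\<theta> \<notin> underS \<nu> \<theta>\<close>
      by (auto simp: W_def closed_subspace_closed_span)
    then show ?thesis using u(1) unfolding good_def by (intro exI[of _ "(u, W \<xi>)"]) simp
  qed
  have "legal_inning \<nu> x y Z \<theta> \<and> Z \<theta> \<in> W ` Field \<kappa>"
    if play: "follows_strategy \<nu> \<sigma> x y Z" and "\<theta> \<in> Field \<nu>" for x y Z \<theta>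
  proof -
    have "wf (\<nu> - Id)" using \<nu>(1) by (simp add: card_order_on_def well_order_on_def)
    then show ?thesis using \<open>\<theta> \<in> Field \<nu>\<close>
    \<comment> \<open>The invariant at earlier stages guarantees a good move, so the choice made by
      \<open>\<sigma>\<close> is good.\<close>
    proof (induction \<theta> rule: wf_induct_rule)
      case (less \<theta>)
      let ?U = "underS \<nu> \<theta>"
      have "Z \<gamma> \<in> W ` Field \<kappa>" if "\<gamma> \<in> ?U" for \<gamma>
        using less.IH[of \<gamma>] that by (auto simp: underS_def Field_def)
      then have "\<exists>p. good \<theta> (restrict x ?U) (restrict y ?U) (restrict Z ?U) p"
        by (intro good_exists less.prems) simp
      then have "good \<theta> (restrict x ?U) (restrict y ?U) (restrict Z ?U) (x \<theta>, Z \<theta>)"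
        using play less.prems unfolding follows_strategy_def \<sigma>_def by (metis someI_ex)
      moreover have "legal_inning \<nu> ((restrict x ?U)(\<theta> := x \<theta>)) (restrict y ?U)
          ((restrict Z ?U)(\<theta> := Z \<theta>)) \<theta> \<longleftrightarrow> legal_inning \<nu> x y Z \<theta>"
        by (rule legal_inning_cong) (auto simp: underS_def)
      ultimately show ?case by (simp add: good_def)
    qed
  qed
  then show ?thesis
    unfolding player_I_has_winning_strategy_def winning_strategy_def by (intro exI[of _ \<sigma>]) simp
qed

theorem theorem4p6:
  fixes \<kappa> :: "'k rel" and X :: "'a::banach itself"
  assumes "Card_order \<kappa>" and "natLeq <o \<kappa>" and "regularCard \<kappa>"
    and "weakly_Lindelof_determined X"
    and "dens (UNIV :: 'a set) =o \<kappa>"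
  shows "(fully_asymptotically_free \<kappa> X
            \<longrightarrow> player_I_has_winning_strategy \<kappa> X)
       \<and> (\<forall>l :: 'l rel. Card_order l \<and> infinite (Field l) \<and> l <o \<kappa> \<and> asymptotically_free l \<kappa> X
            \<longrightarrow> player_I_has_winning_strategy (cardSuc l) X)"
proof (intro conjI impI allI, goal_cases)
  case 1
  obtain B :: "('a \<times> ('a \<Rightarrow>\<^sub>L real)) set" where B: "markushevich_basis B" "property_C TYPE('a)"
    using assms(4) by (auto simp: weakly_Lindelof_determined_def property_C_def)
  have dens: "\<kappa> \<le>o dens (UNIV :: 'a set)"
    using assms(5) ordIso_iff_ordLeq by blast
  \<comment> \<open>The hypothesis speaks of cardinals on the type of \<open>\<kappa>\<close>, but
    densities are realised by subsets of the space; \<open>S\<close> represents \<open>l\<close> on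
    the former type.\<close>
  have free: "asymptotically_free l \<kappa> TYPE('a)" if l: "Card_order l" "l <o \<kappa>" for l :: "'a rel"
  proof -
    have "|Field l| <o \<kappa>" using l(2) by (rule ordLess_Field)
    then obtain S :: "'k set" where S: "|Field l| \<le>o |S|" "|S| <o \<kappa>"
      using iffD1[OF internalize_card_of_ordLess] ordIso_imp_ordLeq by metis
    have "asymptotically_free |S| \<kappa> X"
      using 1 S(2) card_of_Card_order[of S] unfolding fully_asymptotically_free_def by blast
    then have "asymptotically_free |S| \<kappa> TYPE('a)" by (simp only: asymptotically_free_def)
    moreover have "l \<le>o |S|"
      using ordIso_symmetric[OF card_of_Field_ordIso[OF l(1)]] S(1) by (rule ordIso_ordLeq_trans)
    ultimately show ?thesis by (rule asymptotically_free_mono)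
  qed
  have "\<kappa> \<le>o \<kappa>" using assms(1) by (simp add: card_order_on_well_order_on ordLeq_reflexive)
  with free show ?case
    by (intro winning_strategy_exists[OF assms(1-3) dens assms(1,2) _ B]) blast+
next
  case (2 l)
  then have l: "Card_order l" "infinite (Field l)" "l <o \<kappa>" "asymptotically_free l \<kappa> X" by auto
  obtain B :: "('a \<times> ('a \<Rightarrow>\<^sub>L real)) set" where B: "markushevich_basis B" "property_C TYPE('a)"
    using assms(4) by (auto simp: weakly_Lindelof_determined_def property_C_def)
  have dens: "\<kappa> \<le>o dens (UNIV :: 'a set)"
    using assms(5) ordIso_iff_ordLeq by blast
  have "natLeq \<le>o l"
    using l(2) infinite_iff_natLeq_ordLeq card_of_Field_ordIso[OF l(1)] ordLeq_ordIso_trans by blast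
  then have nat: "natLeq <o cardSuc l"
    using cardSuc_greater[OF l(1)] by (rule ordLeq_ordLess_trans)
  have le: "cardSuc l \<le>o \<kappa>" using l(1) assms(1) l(3) by (rule cardSuc_least)
  \<comment> \<open>A cardinal below the successor of \<open>l\<close> is at most \<open>l\<close>,
    so freeness at \<open>l\<close> suffices.\<close>
  have free: "asymptotically_free l' \<kappa> TYPE('a)"
    if "Card_order l'" "l' <o cardSuc l" for l' :: "'a rel"
  proof (rule asymptotically_free_mono)
    show "asymptotically_free l \<kappa> TYPE('a)"
      using l(4) by (simp only: asymptotically_free_def)
    show "l' \<le>o l" using cardSuc_ordLeq_ordLess[OF l(1) that(1)] that(2) by blast
  qed
  then show ?case
    by (intro winning_strategy_exists[OF assms(1-3) dens cardSuc_Card_order[OF l(1)] nat le B]) blast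
qed

end
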